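(* Let $\mu\in\mathbb{R}$, $\sigma>0$ and $\epsilon\in[-1,1]$ with $\epsilon\neq 0$. Then the Stieltjes-class density $$f_\epsilon(y)=f_0(y)\left[1+\epsilon\sin\left\{2\pi(\log y-\mu)/\sigma^2\right\}\right],\qquad y>0,$$ where $$f_0(y)=\frac{1}{\sqrt{2\pi}\,\sigma y}\exp\left\{-\frac12\frac{(\log y-\mu)^2}{\sigma^2}\right\}$$ is the lognormal density, is neither log-symmetric nor R-symmetric.
   Context: A probability density $f$ on $(0,\infty)$ is log-symmetric if there is some $\delta>0$ such that $y^2 f(\delta y)=f(\delta/y)$ for all $y>0$. It is R-symmetric if there is some $\theta>0$ such that $f(\theta y)=f(\theta/y)$ for all $y>0$. *)

theory Defs
  imports "HOL-Probability.Probability"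
begin

(* Densities on (0, infinity) are functions real => real of which only the values at
   positive arguments are ever used. *)
definition pos_prob_density :: "(real \<Rightarrow> real) \<Rightarrow> bool" where
  "pos_prob_density f \<longleftrightarrow>
     (\<forall>y>0. 0 \<le> f y) \<and>
     set_integrable lborel {0<..} f \<and>
     (LINT y:{0<..}|lborel. f y) = 1"

(* The two symmetry notions are meant for f with pos_prob_density f. That condition is not
   a conjunct here, so that their negations cannot hold merely because f is no density. *)
definition log_symmetric :: "(real \<Rightarrow> real) \<Rightarrow> bool" where
  "log_symmetric f \<longleftrightarrow> (\<exists>\<delta>>0. \<forall>y>0. y\<^sup>2 * f (\<delta> * y) = f (\<delta> / y))"

definition R_symmetric :: "(real \<Rightarrow> real) \<Rightarrow> bool" where
  "R_symmetric f \<longleftrightarrow> (\<exists>\<theta>>0. \<forall>y>0. f (\<theta> * y) = f (\<theta> / y))"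

definition lognormal_density :: "real \<Rightarrow> real \<Rightarrow> real \<Rightarrow> real" where
  "lognormal_density \<mu> \<sigma> y =
     1 / (sqrt (2 * pi) * \<sigma> * y) * exp (- (1 / 2) * ((ln y - \<mu>)\<^sup>2 / \<sigma>\<^sup>2))"

definition stieltjes_density :: "real \<Rightarrow> real \<Rightarrow> real \<Rightarrow> real \<Rightarrow> real" where
  "stieltjes_density \<mu> \<sigma> \<epsilon> y =
     lognormal_density \<mu> \<sigma> y * (1 + \<epsilon> * sin (2 * pi * (ln y - \<mu>) / \<sigma>\<^sup>2))"

end

theory Submission
  imports Defs
begin

text \<open>
  Write \<open>y = exp (\<mu> + x)\<close>, so that \<open>f\<^sub>\<epsilon>\<close> becomes a Gaussian factor times the
  perturbation \<open>h x = 1 + \<epsilon> sin (2 \<pi> x / \<sigma>\<^sup>2)\<close>. The perturbation integrates to zero against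
  the Gaussian by oddness, so \<open>f\<^sub>\<epsilon>\<close> is a density. Each symmetry about \<open>exp (\<mu> + d)\<close> turns into
  \<open>exp (- k u) * h (d + u) = h (d - u)\<close> for all \<open>u\<close>, with a constant \<open>k\<close> depending on \<open>d\<close>.
  Periodicity of \<open>h\<close> forces \<open>k = 0\<close>, which means \<open>d = 0\<close> (log-symmetry) or \<open>d = - \<sigma>\<^sup>2\<close>
  (R-symmetry); in both cases \<open>h\<close> would have to be even, and it is not.
\<close>

text \<open>The reflection \<open>x \<mapsto> 2 * c - x\<close> preserves Lebesgue measure, so the
  integral equals its own negative. For a non-integrable \<open>f\<close> this still holds, by the
  default value 0.\<close>

lemma integral_odd_about_eq_0:
  fixes f :: "real \<Rightarrow> real"
  assumes "\<And>x. f (2 * c - x) = - f x"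
  shows "(\<integral>x. f x \<partial>lborel) = 0"
proof -
  have "(\<integral>x. f x \<partial>lborel) = (\<integral>x. f (2 * c + (- 1) * x) \<partial>lborel)"
    using lborel_integral_real_affine[of "- 1" f "2 * c"] by simp
  also have "\<dots> = - (\<integral>x. f x \<partial>lborel)"
    using assms by simp
  finally show ?thesis by simp
qed

text \<open>Change of variables along \<open>ln\<close>, a bijection from the positive half-line
  onto the reals with derivative \<open>1 / y\<close>. The substitution theorem concerns the
  completed measure, so \<open>F\<close> is first moved there from \<open>lborel\<close>.\<close>

lemma set_integral_substitution_ln:
  fixes F :: "real \<Rightarrow> real"
  assumes F: "integrable lborel F"
  shows "set_integrable lborel {0<..} (\<lambda>y. F (ln y) / y)"
    and "(LINT y:{0<..}|lborel. F (ln y) / y) = (\<integral>x. F x \<partial>lborel)"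
proof -
  have [measurable]: "F \<in> borel_measurable borel"
    using F by auto
  have img: "ln ` {0<..} = (UNIV :: real set)"
  proof -
    have "x \<in> ln ` {0<..}" for x :: real
      by (rule image_eqI[of _ _ "exp x"]) auto
    then show ?thesis by auto
  qed
  have absF: "F absolutely_integrable_on UNIV"
    using F unfolding set_integrable_def by (simp add: integrable_completion)
  have intF: "integral UNIV F = (\<integral>x. F x \<partial>lborel)"
    using has_integral_integral_real[OF F] by (rule integral_unique)
  have "(\<lambda>y. \<bar>1 / y\<bar> * F (ln y)) absolutely_integrable_on {0<..} \<and>
      integral {0<..} (\<lambda>y. \<bar>1 / y\<bar> * F (ln y)) = (\<integral>x. F x \<partial>lborel)"
    by (subst has_absolute_integral_change_of_variables_1')
      (auto simp: img absF intF inj_on_def intro!: derivative_eq_intros)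
  moreover have eq: "\<bar>1 / y\<bar> * F (ln y) = F (ln y) / y" if "y \<in> {0<..}" for y
    using that by simp
  moreover have "integral {0<..} (\<lambda>y. \<bar>1 / y\<bar> * F (ln y)) = integral {0<..} (\<lambda>y. F (ln y) / y)"
    by (rule Henstock_Kurzweil_Integration.integral_cong) (rule eq)
  moreover have "(\<lambda>y. \<bar>1 / y\<bar> * F (ln y)) absolutely_integrable_on {0<..} \<longleftrightarrow>
      (\<lambda>y. F (ln y) / y) absolutely_integrable_on {0<..}"
    by (rule set_integrable_cong) (auto simp: eq)
  ultimately have abs: "(\<lambda>y. F (ln y) / y) absolutely_integrable_on {0<..}"
    and int: "integral {0<..} (\<lambda>y. F (ln y) / y) = (\<integral>x. F x \<partial>lborel)"
    by simp_all
  \<comment> \<open>Borel measurability of the integrand allows the return from the completion to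
    \<open>lborel\<close>.\<close>
  show si: "set_integrable lborel {0<..} (\<lambda>y. F (ln y) / y)"
    using abs unfolding set_integrable_def by (subst (asm) integrable_completion) auto
  show "(LINT y:{0<..}|lborel. F (ln y) / y) = (\<integral>x. F x \<partial>lborel)"
    using set_borel_integral_eq_integral(2)[OF si] int by simp
qed

text \<open>Brings the density into the form \<open>F (ln y) / y\<close> required by
  \<open>set_integral_substitution_ln\<close>.\<close>

lemma stieltjes_density_eq_normal_density:
  assumes "\<sigma> > 0"
  shows "stieltjes_density \<mu> \<sigma> \<epsilon> y =
    normal_density \<mu> \<sigma> (ln y) * (1 + \<epsilon> * sin (2 * pi * (ln y - \<mu>) / \<sigma>\<^sup>2)) / y"
proof -
  have "sqrt (2 * pi * \<sigma>\<^sup>2) = sqrt (2 * pi) * \<sigma>"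
    using assms by (simp add: real_sqrt_mult)
  then show ?thesis
    by (simp add: stieltjes_density_def lognormal_density_def normal_density_def)
qed

lemma one_plus_mult_sin_nonneg:
  fixes \<epsilon> t :: real
  assumes "\<bar>\<epsilon>\<bar> \<le> 1"
  shows "0 \<le> 1 + \<epsilon> * sin t"
proof -
  have "\<bar>\<epsilon> * sin t\<bar> \<le> 1"
    using assms by (simp add: abs_mult mult_le_one)
  then show ?thesis by linarith
qed

lemma pos_prob_density_stieltjes_density:
  assumes \<sigma>: "\<sigma> > 0" and \<epsilon>: "\<bar>\<epsilon>\<bar> \<le> 1"
  shows "pos_prob_density (stieltjes_density \<mu> \<sigma> \<epsilon>)"
proof -
  define G where "G x = normal_density \<mu> \<sigma> x * sin (2 * pi * (x - \<mu>) / \<sigma>\<^sup>2)" for x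
  define F where
    "F x = normal_density \<mu> \<sigma> x * (1 + \<epsilon> * sin (2 * pi * (x - \<mu>) / \<sigma>\<^sup>2))" for x
  have F_G: "F = (\<lambda>x. normal_density \<mu> \<sigma> x + \<epsilon> * G x)"
    by (auto simp: F_def G_def algebra_simps)
  have f_F: "stieltjes_density \<mu> \<sigma> \<epsilon> = (\<lambda>y. F (ln y) / y)"
    using \<sigma> by (auto simp: stieltjes_density_eq_normal_density F_def)
  \<comment> \<open>Since the sine is bounded by 1, the normal density dominates
    \<open>G\<close>.\<close>
  have intble_G: "integrable lborel G"
  proof (rule Bochner_Integration.integrable_bound[OF integrable_normal_density[OF \<sigma>, of \<mu>]])
    show "G \<in> borel_measurable lborel"
      unfolding G_def by measurable
    show "AE x in lborel. norm (G x) \<le> norm (normal_density \<mu> \<sigma> x)"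
      by (auto simp: G_def abs_mult intro!: mult_left_le)
  qed
  have "2 * pi * ((2 * \<mu> - x) - \<mu>) / \<sigma>\<^sup>2 = - (2 * pi * (x - \<mu>) / \<sigma>\<^sup>2)" for x
    unfolding minus_divide_left by (simp add: algebra_simps)
  then have "G (2 * \<mu> - x) = - G x" for x
    unfolding G_def by (simp add: normal_density_def power2_commute)
  then have "(\<integral>x. G x \<partial>lborel) = 0"
    by (rule integral_odd_about_eq_0)
  then have "integrable lborel F" "(\<integral>x. F x \<partial>lborel) = 1"
    using intble_G \<sigma> by (simp_all add: F_G)
  moreover have "0 \<le> F x" for x
    unfolding F_def using one_plus_mult_sin_nonneg[OF \<epsilon>] normal_density_nonneg by simp
  ultimately show ?thesis
    unfolding pos_prob_density_def f_F
    using set_integral_substitution_ln[of F] by simp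
qed

text \<open>The factor \<open>1 / y\<close> of the lognormal density supplies
  \<open>exp (- \<mu>)\<close> and the linear term \<open>- x\<close> in the exponent. The constant
  stands in front so that it cancels from both sides of a symmetry equation.\<close>

lemma stieltjes_density_exp:
  "stieltjes_density \<mu> \<sigma> \<epsilon> (exp (\<mu> + x)) =
    exp (- \<mu>) / (sqrt (2 * pi) * \<sigma>) *
    (exp (- x - x\<^sup>2 / (2 * \<sigma>\<^sup>2)) * (1 + \<epsilon> * sin (2 * pi * x / \<sigma>\<^sup>2)))"
  unfolding stieltjes_density_def lognormal_density_def ln_exp
  by (simp add: exp_add exp_diff exp_minus field_simps)

text \<open>The reflection identity is tested at \<open>u\<close> equal to a full, a half and a
  quarter period \<open>s\<close> of \<open>h\<close>.\<close>

lemma perturbation_reflection: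
  fixes s \<epsilon> d k :: real
  defines "h \<equiv> \<lambda>x. 1 + \<epsilon> * sin (2 * pi * x / s)"
  assumes s: "s > 0" and \<epsilon>: "\<epsilon> \<noteq> 0"
    and refl: "\<And>u. exp (- k * u) * h (d + u) = h (d - u)"
  shows "k = 0" and "cos (2 * pi * d / s) = 0"
proof -
  have shift: "2 * pi * (d + c * s) / s = 2 * pi * d / s + c * (2 * pi)"
    "2 * pi * (d - c * s) / s = 2 * pi * d / s - c * (2 * pi)" for c
    using s by (simp_all add: field_simps)
  have full: "h (d + s) = h d" "h (d - s) = h d"
    using shift[of 1] by (simp_all add: h_def sin_diff)
  have half: "h (d + s / 2) = 2 - h d" "h (d - s / 2) = 2 - h d"
    using shift[of "1 / 2"] by (simp_all add: h_def sin_diff)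
  show "k = 0"
  \<comment> \<open>At \<open>u = s\<close> both values of \<open>h\<close> are \<open>h d\<close>,
    which cancels unless it vanishes. In that case \<open>u = s / 2\<close> serves, where both
    values are 2.\<close>
  proof (cases "h d = 0")
    case True
    then show ?thesis using refl[of "s / 2"] half s by simp
  next
    case False
    then show ?thesis using refl[of s] full s by simp
  qed
  \<comment> \<open>A quarter period turns the sine into plus or minus the cosine of the phase at
    \<open>d\<close>.\<close>
  then have "h (d + s / 4) = h (d - s / 4)"
    using refl[of "s / 4"] by simp
  moreover have "h (d + s / 4) = 1 + \<epsilon> * cos (2 * pi * d / s)"
    "h (d - s / 4) = 1 - \<epsilon> * cos (2 * pi * d / s)"
    using shift[of "1 / 4"] by (simp_all add: h_def sin_add sin_diff)
  ultimately show "cos (2 * pi * d / s) = 0"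
    using \<epsilon> by simp
qed

lemma not_log_symmetric_stieltjes_density:
  assumes \<sigma>: "\<sigma> > 0" and \<epsilon>: "\<epsilon> \<noteq> 0"
  shows "\<not> log_symmetric (stieltjes_density \<mu> \<sigma> \<epsilon>)"
proof
  assume "log_symmetric (stieltjes_density \<mu> \<sigma> \<epsilon>)"
  then obtain \<delta> where "\<delta> > 0" and
    sym: "\<And>y. y > 0 \<Longrightarrow> y\<^sup>2 * stieltjes_density \<mu> \<sigma> \<epsilon> (\<delta> * y) = stieltjes_density \<mu> \<sigma> \<epsilon> (\<delta> / y)"
    by (auto simp: log_symmetric_def)
  define d where "d = ln \<delta> - \<mu>"
  define g where "g x = exp (- x - x\<^sup>2 / (2 * \<sigma>\<^sup>2))" for x
  define h where "h x = 1 + \<epsilon> * sin (2 * pi * x / \<sigma>\<^sup>2)" for x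
  have \<delta>: "\<delta> = exp (\<mu> + d)"
    using \<open>\<delta> > 0\<close> by (simp add: d_def)
  \<comment> \<open>From \<open>d - u\<close> to \<open>d + u\<close> the exponent in
    \<open>g\<close> changes by \<open>- 2 * u - 2 * d * u / \<sigma>\<^sup>2\<close>; the factor
    \<open>y\<^sup>2 = exp (2 * u)\<close> removes the first term.\<close>
  have refl: "exp (- (2 * d / \<sigma>\<^sup>2) * u) * h (d + u) = h (d - u)" for u
  proof -
    have "exp u ^ 2 * stieltjes_density \<mu> \<sigma> \<epsilon> (exp (\<mu> + (d + u))) =
        stieltjes_density \<mu> \<sigma> \<epsilon> (exp (\<mu> + (d - u)))"
      using sym[of "exp u"] by (simp add: \<delta> exp_add exp_diff mult.assoc)
    then have "exp (2 * u) * g (d + u) * h (d + u) =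
        g (d - u) * h (d - u)"
      using \<sigma> unfolding stieltjes_density_exp g_def[symmetric] h_def[symmetric]
      by (simp add: exp_double)
    moreover have "exp (2 * u) * g (d + u) =
        g (d - u) * exp (- (2 * d / \<sigma>\<^sup>2) * u)"
      unfolding g_def exp_add[symmetric] using \<sigma> by (simp add: field_simps power2_eq_square)
    ultimately have "g (d - u) * (exp (- (2 * d / \<sigma>\<^sup>2) * u) * h (d + u)) = g (d - u) * h (d - u)"
      by (simp only: mult.assoc[symmetric])
    moreover have "g (d - u) \<noteq> 0"
      by (simp add: g_def)
    ultimately show ?thesis
      by (simp only: mult_cancel_left simp_thms)
  qed
  have "2 * d / \<sigma>\<^sup>2 = 0" "cos (2 * pi * d / \<sigma>\<^sup>2) = 0"
    using perturbation_reflection[OF zero_less_power[OF \<sigma>] \<epsilon> refl[unfolded h_def]] .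
  \<comment> \<open>Here \<open>d = 0\<close>, so the cosine is 1.\<close>
  then show False using \<sigma> by simp
qed

lemma not_R_symmetric_stieltjes_density:
  assumes \<sigma>: "\<sigma> > 0" and \<epsilon>: "\<epsilon> \<noteq> 0"
  shows "\<not> R_symmetric (stieltjes_density \<mu> \<sigma> \<epsilon>)"
proof
  assume "R_symmetric (stieltjes_density \<mu> \<sigma> \<epsilon>)"
  then obtain \<theta> where "\<theta> > 0" and
    sym: "\<And>y. y > 0 \<Longrightarrow> stieltjes_density \<mu> \<sigma> \<epsilon> (\<theta> * y) = stieltjes_density \<mu> \<sigma> \<epsilon> (\<theta> / y)"
    by (auto simp: R_symmetric_def)
  define d where "d = ln \<theta> - \<mu>"
  define g where "g x = exp (- x - x\<^sup>2 / (2 * \<sigma>\<^sup>2))" for x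
  define h where "h x = 1 + \<epsilon> * sin (2 * pi * x / \<sigma>\<^sup>2)" for x
  have \<theta>: "\<theta> = exp (\<mu> + d)"
    using \<open>\<theta> > 0\<close> by (simp add: d_def)
  \<comment> \<open>Without a factor \<open>y\<^sup>2\<close>, the term \<open>- 2 * u\<close> of
    the exponent stays and adds 2 to the constant.\<close>
  have refl: "exp (- (2 + 2 * d / \<sigma>\<^sup>2) * u) * h (d + u) = h (d - u)" for u
  proof -
    have "stieltjes_density \<mu> \<sigma> \<epsilon> (exp (\<mu> + (d + u))) =
        stieltjes_density \<mu> \<sigma> \<epsilon> (exp (\<mu> + (d - u)))"
      using sym[of "exp u"] by (simp add: \<theta> exp_add exp_diff mult.assoc)
    then have "g (d + u) * h (d + u) =
        g (d - u) * h (d - u)"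
      using \<sigma> unfolding stieltjes_density_exp g_def[symmetric] h_def[symmetric] by simp
    moreover have "g (d + u) =
        g (d - u) * exp (- (2 + 2 * d / \<sigma>\<^sup>2) * u)"
      unfolding g_def exp_add[symmetric] using \<sigma> by (simp add: field_simps power2_eq_square)
    ultimately have "g (d - u) * (exp (- (2 + 2 * d / \<sigma>\<^sup>2) * u) * h (d + u)) = g (d - u) * h (d - u)"
      by (simp only: mult.assoc[symmetric])
    moreover have "g (d - u) \<noteq> 0"
      by (simp add: g_def)
    ultimately show ?thesis
      by (simp only: mult_cancel_left simp_thms)
  qed
  have "2 + 2 * d / \<sigma>\<^sup>2 = 0" "cos (2 * pi * d / \<sigma>\<^sup>2) = 0"
    using perturbation_reflection[OF zero_less_power[OF \<sigma>] \<epsilon> refl[unfolded h_def]] .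
  moreover from this(1) have "d / \<sigma>\<^sup>2 = - 1"
    by linarith
  \<comment> \<open>The only possible centre is thus \<open>exp (\<mu> - \<sigma>\<^sup>2)\<close>,
    the mode of the lognormal density. The phase there is \<open>- 2 * pi\<close>, whose cosine is
    again 1.\<close>
  then have "d = - \<sigma>\<^sup>2"
    using \<sigma> by (simp add: divide_eq_eq)
  ultimately show False
    using \<sigma> by simp
qed

theorem mainTheorem4:
  fixes \<mu> \<sigma> \<epsilon> :: real
  assumes "\<sigma> > 0" and "\<epsilon> \<in> {-1..1}" and "\<epsilon> \<noteq> 0"
  shows "pos_prob_density (stieltjes_density \<mu> \<sigma> \<epsilon>)
    \<and> \<not> log_symmetric (stieltjes_density \<mu> \<sigma> \<epsilon>)
    \<and> \<not> R_symmetric (stieltjes_density \<mu> \<sigma> \<epsilon>)"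
proof (intro conjI)
  show "pos_prob_density (stieltjes_density \<mu> \<sigma> \<epsilon>)"
    using assms by (intro pos_prob_density_stieltjes_density) auto
qed (use assms in \<open>simp_all add: not_log_symmetric_stieltjes_density
    not_R_symmetric_stieltjes_density\<close>)

end
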